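(* Let $k=\mathbb{Q}[y,y^{-1}]$ and let $H^n(X;k)$ denote the Yang-Baxter cohomology of $X=(V,R)$ with coefficients in $k$, as defined in the context. Then, as $k$-modules, $$H^2(X;k)\cong k^{\oplus2},\qquad H^3(X;k)\cong k^{\oplus2}\oplus k/(1-y^2)\oplus k/(1-y^4).$$
   Context: $V$ is the free $k$-module with basis $e_1,e_2$; tensor products are over $k$, and $\mathbb{1}^m$ is the identity of $V^{\otimes m}$ ($V^{\otimes0}=k$). The map $R:V\otimes V\to V\otimes V$ is the $k$-linear map with $R(e_1\otimes e_1)=e_1\otimes e_1$, $R(e_1\otimes e_2)=(1-y^2)e_1\otimes e_2+y^2e_2\otimes e_1$, $R(e_2\otimes e_1)=e_1\otimes e_2$, $R(e_2\otimes e_2)=e_2\otimes e_2$. Let $\mu:V\to k$ be the $k$-linear map with $\mu(e_1)=\mu(e_2)=1$. For $1\le i\le n$ define $d^\ell_{i,n},d^r_{i,n}:V^{\otimes n}\to V^{\otimes(n-1)}$ by $$d^\ell_{i,n}=(\mu\otimes\mathbb{1}^{n-1})\circ(R\otimes\mathbb{1}^{n-2})\circ(\mathbb{1}\otimes R\otimes\mathbb{1}^{n-3})\circ\cdots\circ(\mathbb{1}^{i-2}\otimes R\otimes\mathbb{1}^{n-i}),$$ $$d^r_{i,n}=(\mathbb{1}^{n-1}\otimes\mu)\circ(\mathbb{1}^{n-2}\otimes R)\circ(\mathbb{1}^{n-3}\otimes R\otimes\mathbb{1})\circ\cdots\circ(\mathbb{1}^{i-1}\otimes R\otimes\mathbb{1}^{n-i-1}),$$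 (so $d^\ell_{1,n}=\mu\otimes\mathbb{1}^{n-1}$ and $d^r_{n,n}=\mathbb{1}^{n-1}\otimes\mu$). Set $C_n(X)=V^{\otimes n}$ and $d_n=\sum_{i=1}^n(-1)^i[\,d^\ell_{i,n}-d^r_{i,n}\,]:C_n(X)\to C_{n-1}(X)$; these form a chain complex. The Yang-Baxter cochain complex is its dual: $C^n(X;k)=\operatorname{Hom}_k(C_n(X),k)$, with $\delta^{n+1}:C^n(X;k)\to C^{n+1}(X;k)$, $\delta^{n+1}(f)=f\circ d_{n+1}$, and $H^n(X;k)=\ker\delta^{n+1}/\operatorname{im}\delta^{n}$. *)

theory Defs
  imports
    "HOL-Library.Poly_Mapping"
    "HOL-Algebra.Algebraic_Closure_Type"
    "HOL-Algebra.QuotRing"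
    "Jordan_Normal_Form.Missing_VectorSpace"
begin

section \<open>Modules\<close>

definition regular_module :: "'a ring \<Rightarrow> ('a, 'a) module" where
  "regular_module K = \<lparr>carrier = carrier K, monoid.mult = monoid.mult K, one = one K,
     zero = zero K, add = add K, module.smult = monoid.mult K\<rparr>"

text \<open>The type of \<open>module\<close> records inherits the fields \<open>mult\<close> and \<open>one\<close> from
  rings; they play no role for modules and are given arbitrary values below.\<close>

definition quotient_module :: "('a, 'b) module \<Rightarrow> 'b set \<Rightarrow> ('a, 'b set) module" where
  "quotient_module M N = \<lparr>carrier = a_rcosets\<^bsub>M\<^esub> N, monoid.mult = (\<lambda>_ _. N), one = N,
     zero = N, add = set_add M, module.smult = (\<lambda>r A. \<Union>x\<in>A. N +>\<^bsub>M\<^esub> (r \<odot>\<^bsub>M\<^esub> x))\<rparr>"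

text \<open>Linear maps are restricted to the carrier (\<open>extensional\<close>), so that two of
  them are equal as soon as they agree on \<open>M\<close>; addition and scalar multiplication
  are the pointwise ones of \<open>func_space\<close>.\<close>

definition dual_module :: "'a ring \<Rightarrow> ('a, 'b) module \<Rightarrow> ('a, 'b \<Rightarrow> 'a) module" where
  "dual_module K M = (ring.func_space K (carrier M))
     \<lparr>carrier := module_hom K M (regular_module K) \<inter> extensional (carrier M)\<rparr>"

definition module_isomorphic :: "'a ring \<Rightarrow> ('a, 'b) module \<Rightarrow> ('a, 'c) module \<Rightarrow> bool" where
  "module_isomorphic K M N \<longleftrightarrow>
     (\<exists>f \<in> module_hom K M N. bij_betw f (carrier M) (carrier N))"


section \<open>Tensor powers of the free module of rank two\<close>

datatype letter = E1 | E2

text \<open>\<open>V\<close> is free on \<open>e\<^sub>1, e\<^sub>2\<close>, so the \<open>n\<close>-th tensor power of \<open>V\<close> is free on the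
  tensors \<open>e\<^sub>a \<otimes> \<dots> \<otimes> e\<^sub>b\<close> with \<open>n\<close> factors, that is, on the words of length \<open>n\<close>.
  A finitely supported function on words is an element of the direct sum of all
  tensor powers; the empty word spans the 0-th power, which is the ground ring.\<close>

type_synonym 'k tensor = "letter list \<Rightarrow>\<^sub>0 'k"

abbreviation basis :: "letter list \<Rightarrow> 'k::comm_ring_1 tensor" where
  "basis w \<equiv> Poly_Mapping.single w 1"

definition scale :: "'k::comm_ring_1 \<Rightarrow> 'k tensor \<Rightarrow> 'k tensor" where
  "scale c x = Poly_Mapping.map ((*) c) x"

definition tensor_power :: "nat \<Rightarrow> ('k::comm_ring_1, 'k tensor) module" where
  "tensor_power n = \<lparr>carrier = {x. \<forall>w \<in> Poly_Mapping.keys x. length w = n},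
     monoid.mult = (\<lambda>_ _. 0), one = 0, zero = 0, add = (+), module.smult = scale\<rparr>"

definition linear_extension ::
  "(letter list \<Rightarrow> 'k tensor) \<Rightarrow> 'k::comm_ring_1 tensor \<Rightarrow> 'k tensor" where
  "linear_extension F x =
     (\<Sum>w \<in> Poly_Mapping.keys x. scale (Poly_Mapping.lookup x w) (F w))"

text \<open>The bilinear map with \<open>e\<^sub>u \<otimes> e\<^sub>v = e\<^sub>u\<^sub>v\<close>, where \<open>uv\<close> is the concatenation.\<close>

definition tensor :: "'k::comm_ring_1 tensor \<Rightarrow> 'k tensor \<Rightarrow> 'k tensor" where
  "tensor x y =
     linear_extension (\<lambda>u. linear_extension (\<lambda>v. basis (u @ v)) y) x"

text \<open>\<open>tensor_map p f g\<close> is \<open>f \<otimes> g\<close> for linear maps \<open>f\<close> on the \<open>p\<close>-th tensor power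
  and \<open>g\<close> on the \<open>q\<close>-th one. It is meant to be applied to elements of the \<open>(p+q)\<close>-th
  power, so \<open>q\<close> need not be given. In particular \<open>tensor_map p f id\<close> is
  \<open>f\<close> tensored with the identity of whichever power makes the degrees match.\<close>

definition tensor_map ::
  "nat \<Rightarrow> ('k tensor \<Rightarrow> 'k tensor) \<Rightarrow> ('k tensor \<Rightarrow> 'k tensor)
    \<Rightarrow> 'k::comm_ring_1 tensor \<Rightarrow> 'k tensor" where
  "tensor_map p f g =
     linear_extension (\<lambda>w. tensor (f (basis (take p w))) (g (basis (drop p w))))"


section \<open>The Yang-Baxter complex\<close>

text \<open>Only the values on words of length 2 (for \<open>R\<close>) and 1 (for \<open>\<mu>\<close>) matter.\<close>

fun R_basis :: "'k \<Rightarrow> letter list \<Rightarrow> 'k::comm_ring_1 tensor" where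
  "R_basis y [E1, E1] = basis [E1, E1]"
| "R_basis y [E1, E2] = scale (1 - y^2) (basis [E1, E2]) + scale (y^2) (basis [E2, E1])"
| "R_basis y [E2, E1] = basis [E1, E2]"
| "R_basis y [E2, E2] = basis [E2, E2]"
| "R_basis y _ = 0"

definition YB_R :: "'k \<Rightarrow> 'k tensor \<Rightarrow> 'k::comm_ring_1 tensor" where
  "YB_R y = linear_extension (R_basis y)"

fun mu_basis :: "letter list \<Rightarrow> 'k::comm_ring_1 tensor" where
  "mu_basis [E1] = basis []"
| "mu_basis [E2] = basis []"
| "mu_basis _ = 0"

definition mu :: "'k tensor \<Rightarrow> 'k::comm_ring_1 tensor" where
  "mu = linear_extension mu_basis"

text \<open>\<open>R\<close> applied to the tensor factors \<open>j + 1\<close> and \<open>j + 2\<close>.\<close>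

definition R_at :: "'k \<Rightarrow> nat \<Rightarrow> 'k tensor \<Rightarrow> 'k::comm_ring_1 tensor" where
  "R_at y j = tensor_map j id (tensor_map 2 (YB_R y) id)"

text \<open>Left faces: \<open>R\<close> acts at \<open>j = i - 2, \<dots>, 1, 0\<close> in this order, then \<open>\<mu>\<close> acts on the
  first factor. Right faces: \<open>R\<close> acts at \<open>j = i - 1, \<dots>, n - 2\<close> in this order, then \<open>\<mu>\<close>
  acts on the last factor. The formula for the left face does not involve \<open>n\<close>, which
  occurs only in the identity on the trailing factors.\<close>

definition left_face :: "'k \<Rightarrow> nat \<Rightarrow> 'k tensor \<Rightarrow> 'k::comm_ring_1 tensor" where
  "left_face y i = tensor_map 1 mu id \<circ> foldr (\<circ>) (map (R_at y) [0..<i - 1]) id"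

definition right_face :: "'k \<Rightarrow> nat \<Rightarrow> nat \<Rightarrow> 'k tensor \<Rightarrow> 'k::comm_ring_1 tensor" where
  "right_face y n i =
     tensor_map (n - 1) id mu \<circ> foldr (\<circ>) (map (R_at y) (rev [i - 1..<n - 1])) id"

definition boundary :: "'k \<Rightarrow> nat \<Rightarrow> 'k tensor \<Rightarrow> 'k::comm_ring_1 tensor" where
  "boundary y n x =
     (\<Sum>i = 1..n. scale ((-1) ^ i) (left_face y i x - right_face y n i x))"

definition cochain_module :: "nat \<Rightarrow> ('k::comm_ring_1, 'k tensor \<Rightarrow> 'k) module" where
  "cochain_module n = dual_module ring_of_type_algebra (tensor_power n)"

text \<open>\<open>coboundary y n\<close> goes from degree \<open>n - 1\<close> to degree \<open>n\<close>. For \<open>n = 0\<close> it is the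
  zero map, because \<open>boundary y 0\<close> is the empty sum.\<close>

definition coboundary :: "'k \<Rightarrow> nat \<Rightarrow> ('k tensor \<Rightarrow> 'k) \<Rightarrow> 'k::comm_ring_1 tensor \<Rightarrow> 'k" where
  "coboundary y n f = restrict (f \<circ> boundary y n) (carrier (tensor_power n))"

definition YB_cohomology ::
  "'k \<Rightarrow> nat \<Rightarrow> ('k::comm_ring_1, ('k tensor \<Rightarrow> 'k) set) module" where
  "YB_cohomology y n = quotient_module
     ((cochain_module n)
       \<lparr>carrier := a_kernel (cochain_module n) (cochain_module (n + 1)) (coboundary y (n + 1))\<rparr>)
     (coboundary y n ` carrier (cochain_module (n - 1)))"


section \<open>Laurent polynomials over the rationals\<close>

text \<open>Finitely supported families of coefficients indexed by integer exponents, with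
  the convolution product of \<open>Poly_Mapping\<close>.\<close>

type_synonym laurent = "int \<Rightarrow>\<^sub>0 rat"

abbreviation laurent_ring :: "laurent ring" where
  "laurent_ring \<equiv> ring_of_type_algebra"

definition y_var :: laurent where
  "y_var = Poly_Mapping.single 1 1"

definition cyclic_quotient :: "laurent \<Rightarrow> (laurent, laurent set) module" where
  "cyclic_quotient a = quotient_module (regular_module laurent_ring) (PIdl\<^bsub>laurent_ring\<^esub> a)"

end

theory Submission
  imports Defs
begin

text \<open>
  A cochain of degree \<open>n\<close> is a function on words of length \<open>n\<close>. Writing \<open>t = y\<^sup>2\<close>, the coboundary
  out of degree 1 vanishes, and the 2-cocycles are the \<open>f\<close> with
  \<open>f\<^sub>1\<^sub>2 = (1 + t) f\<^sub>1\<^sub>1 - t f\<^sub>2\<^sub>1\<close> and \<open>f\<^sub>2\<^sub>2 = f\<^sub>1\<^sub>1\<close>; so \<open>H\<^sup>2\<close> is free on \<open>f\<^sub>1\<^sub>1, f\<^sub>2\<^sub>1\<close>. A 3-cocycle is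
  determined by \<open>f\<^sub>1\<^sub>1\<^sub>1, f\<^sub>2\<^sub>1\<^sub>1, f\<^sub>1\<^sub>1\<^sub>2, f\<^sub>1\<^sub>2\<^sub>2\<close>, which are arbitrary, and it is a coboundary iff the
  first two vanish, \<open>1 - t\<close> divides \<open>f\<^sub>1\<^sub>1\<^sub>2\<close>, and \<open>1 - t\<^sup>2\<close> divides \<open>f\<^sub>1\<^sub>1\<^sub>2 + f\<^sub>1\<^sub>2\<^sub>2\<close>. All this works
  over any integral domain in which \<open>y\<^sup>4 \<noteq> 1\<close>.
\<close>

section \<open>Quotient modules\<close>

text \<open>Closure under negation comes from closure under scalars, because -a is (-1) times
  a.\<close>

lemma submoduleI_smult:
  assumes "Module.module R M" "H \<subseteq> carrier M" "\<zero>\<^bsub>M\<^esub> \<in> H"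
    and "\<And>a b. a \<in> H \<Longrightarrow> b \<in> H \<Longrightarrow> a \<oplus>\<^bsub>M\<^esub> b \<in> H"
    and smult: "\<And>r a. r \<in> carrier R \<Longrightarrow> a \<in> H \<Longrightarrow> r \<odot>\<^bsub>M\<^esub> a \<in> H"
  shows "Module.submodule H R M"
proof -
  interpret M: module R M by fact
  have "\<ominus>\<^bsub>M\<^esub> a \<in> H" if "a \<in> H" for a
  proof -
    have "\<ominus>\<^bsub>M\<^esub> a = (\<ominus>\<^bsub>R\<^esub> \<one>\<^bsub>R\<^esub>) \<odot>\<^bsub>M\<^esub> a"
      using that assms(2) by (simp add: subsetD M.smult_l_minus)
    then show ?thesis using smult[of "\<ominus>\<^bsub>R\<^esub> \<one>\<^bsub>R\<^esub>" a] that by simp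
  qed
  then show ?thesis using assms by (intro M.submoduleI) auto
qed

lemma submodule_abelian_subgroup:
  assumes "Module.module K M" "Module.submodule B K M"
  shows "abelian_subgroup B M"
  using assms by (intro abelian_subgroupI3)
    (auto simp: additive_subgroup_def Module.submodule_def Module.module_def)

lemma module_quotient_add:
  assumes "Module.module K M" "Module.submodule B K M" "x \<in> carrier M" "y \<in> carrier M"
  shows "(B +>\<^bsub>M\<^esub> x) \<oplus>\<^bsub>quotient_module M B\<^esub> (B +>\<^bsub>M\<^esub> y) = B +>\<^bsub>M\<^esub> (x \<oplus>\<^bsub>M\<^esub> y)"
proof -
  interpret M: module K M by fact
  interpret abelian_subgroup B M using assms(1,2) by (rule submodule_abelian_subgroup)
  show ?thesis using a_rcos_sum assms by (simp add: quotient_module_def)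
qed

text \<open>The union in \<open>quotient_module\<close> runs over a nonempty coset, and all its
  members contribute the same set: for z = b + x the element r z differs from r x by r b, which lies
  in \<open>B\<close>.\<close>

lemma module_quotient_smult:
  assumes "Module.module K M" "Module.submodule B K M" "r \<in> carrier K" "x \<in> carrier M"
  shows "r \<odot>\<^bsub>quotient_module M B\<^esub> (B +>\<^bsub>M\<^esub> x) = B +>\<^bsub>M\<^esub> (r \<odot>\<^bsub>M\<^esub> x)"
proof -
  interpret M: module K M by fact
  interpret S: abelian_subgroup B M using assms(1,2) by (rule submodule_abelian_subgroup)
  have "B +>\<^bsub>M\<^esub> (r \<odot>\<^bsub>M\<^esub> z) = B +>\<^bsub>M\<^esub> (r \<odot>\<^bsub>M\<^esub> x)" if z: "z \<in> B +>\<^bsub>M\<^esub> x" for z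
  proof -
    obtain b where b: "b \<in> B" "z = b \<oplus>\<^bsub>M\<^esub> x"
      using z by (auto simp: a_r_coset_def' )
    have bc: "b \<in> carrier M" using b by simp
    have "r \<odot>\<^bsub>M\<^esub> z = r \<odot>\<^bsub>M\<^esub> b \<oplus>\<^bsub>M\<^esub> r \<odot>\<^bsub>M\<^esub> x"
      using assms bc by (simp add: b M.smult_r_distr)
    moreover have "r \<odot>\<^bsub>M\<^esub> b \<in> B"
      using assms b by (auto dest: Module.submodule.smult_closed)
    ultimately have "r \<odot>\<^bsub>M\<^esub> z \<in> B +>\<^bsub>M\<^esub> (r \<odot>\<^bsub>M\<^esub> x)"
      by (auto simp: a_r_coset_def')
    then show ?thesis
      using S.a_repr_independence' assms by (metis M.smult_closed)
  qed
  moreover have "B +>\<^bsub>M\<^esub> x \<noteq> {}" using S.a_rcos_self assms by blast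
  ultimately have "(\<Union>z\<in>B +>\<^bsub>M\<^esub> x. B +>\<^bsub>M\<^esub> (r \<odot>\<^bsub>M\<^esub> z)) = B +>\<^bsub>M\<^esub> (r \<odot>\<^bsub>M\<^esub> x)"
    by (intro SUP_eq_const)
  then show ?thesis by (simp add: quotient_module_def)
qed

lemma quotient_carrier: "carrier (quotient_module M B) = (\<lambda>x. B +>\<^bsub>M\<^esub> x) ` carrier M"
  by (auto simp: quotient_module_def A_RCOSETS_def')

lemma coset_eq_iff:
  assumes "Module.module K M" "Module.submodule B K M" "x \<in> carrier M" "y \<in> carrier M"
  shows "B +>\<^bsub>M\<^esub> x = B +>\<^bsub>M\<^esub> y \<longleftrightarrow> x \<oplus>\<^bsub>M\<^esub> \<ominus>\<^bsub>M\<^esub> y \<in> B"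
proof -
  interpret S: abelian_subgroup B M using assms(1,2) by (rule submodule_abelian_subgroup)
  show ?thesis
    using assms S.a_rcos_module S.a_repr_independence' S.a_repr_independenceD by metis
qed

text \<open>First isomorphism theorem. The target \<open>T\<close> is given only by its carrier and
  operations, so the kernel is written as the fibre over the image of the zero of \<open>M\<close>,
  and all cancellation happens in \<open>M\<close>.\<close>

theorem quotient_module_isomorphic:
  assumes M: "Module.module K M" and hom: "\<phi> \<in> module_hom K M T"
    and surj: "\<phi> ` carrier M = carrier T"
    and B: "B = {x \<in> carrier M. \<phi> x = \<phi> \<zero>\<^bsub>M\<^esub>}"
  shows "module_isomorphic K (quotient_module M B) T"
proof -
  interpret M: module K M by fact
  note add = module_hom_add[OF hom] and smult = module_hom_smult[OF hom]
  have plus: "a \<oplus>\<^bsub>M\<^esub> b \<in> B" if "a \<in> B" "b \<in> B" for a b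
    using that add[of a b] add[of "\<zero>\<^bsub>M\<^esub>" "\<zero>\<^bsub>M\<^esub>"] by (auto simp: B)
  have mult: "r \<odot>\<^bsub>M\<^esub> a \<in> B" if "r \<in> carrier K" "a \<in> B" for r a
    using that smult[of r a] smult[of r "\<zero>\<^bsub>M\<^esub>"] by (auto simp: B)
  have sub: "Module.submodule B K M"
    by (rule submoduleI_smult[OF M _ _ plus mult]) (auto simp: B)
  \<comment> \<open>Subtraction is carried out before \<open>\<phi>\<close> is applied: add -y to
    both arguments in one direction, add y back in the other.\<close>
  have eq_iff: "\<phi> x = \<phi> y \<longleftrightarrow> B +>\<^bsub>M\<^esub> x = B +>\<^bsub>M\<^esub> y" if xy: "x \<in> carrier M" "y \<in> carrier M" for x y
  proof
    assume "\<phi> x = \<phi> y"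
    then have "\<phi> (x \<oplus>\<^bsub>M\<^esub> \<ominus>\<^bsub>M\<^esub> y) = \<phi> (y \<oplus>\<^bsub>M\<^esub> \<ominus>\<^bsub>M\<^esub> y)"
      using xy by (simp add: add)
    then have "x \<oplus>\<^bsub>M\<^esub> \<ominus>\<^bsub>M\<^esub> y \<in> B" using xy by (simp add: B M.r_neg)
    then show "B +>\<^bsub>M\<^esub> x = B +>\<^bsub>M\<^esub> y" using coset_eq_iff[OF M sub] xy by blast
  next
    assume "B +>\<^bsub>M\<^esub> x = B +>\<^bsub>M\<^esub> y"
    then have "x \<oplus>\<^bsub>M\<^esub> \<ominus>\<^bsub>M\<^esub> y \<in> B" using coset_eq_iff[OF M sub] xy by blast
    then have "\<phi> ((x \<oplus>\<^bsub>M\<^esub> \<ominus>\<^bsub>M\<^esub> y) \<oplus>\<^bsub>M\<^esub> y) = \<phi> (\<zero>\<^bsub>M\<^esub> \<oplus>\<^bsub>M\<^esub> y)"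
      using xy add[of "x \<oplus>\<^bsub>M\<^esub> \<ominus>\<^bsub>M\<^esub> y" y] add[of "\<zero>\<^bsub>M\<^esub>" y] by (auto simp: B)
    then show "\<phi> x = \<phi> y" using xy by (simp add: M.a_assoc M.l_neg)
  qed
  \<comment> \<open>The induced map evaluates \<open>\<phi>\<close> at a chosen representative;
    \<open>eq_iff\<close> makes the value independent of the choice and the map injective.\<close>
  define f where "f A = \<phi> (SOME x. x \<in> carrier M \<and> A = B +>\<^bsub>M\<^esub> x)" for A
  have f: "f (B +>\<^bsub>M\<^esub> x) = \<phi> x" if x: "x \<in> carrier M" for x
  proof -
    let ?z = "SOME z. z \<in> carrier M \<and> B +>\<^bsub>M\<^esub> x = B +>\<^bsub>M\<^esub> z"
    have "?z \<in> carrier M \<and> B +>\<^bsub>M\<^esub> x = B +>\<^bsub>M\<^esub> ?z"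
      by (rule someI[of _ x]) (simp add: x)
    then show ?thesis using eq_iff x by (simp add: f_def)
  qed
  have "f \<in> module_hom K (quotient_module M B) T"
    using surj by (auto simp: module_hom_def quotient_carrier f module_quotient_add[OF M sub]
        module_quotient_smult[OF M sub] add smult)
  moreover have "bij_betw f (carrier (quotient_module M B)) (carrier T)"
    unfolding bij_betw_def inj_on_def quotient_carrier using surj
    by (auto simp: f eq_iff image_image)
  ultimately show ?thesis by (auto simp: module_isomorphic_def)
qed

section \<open>The ground ring as a module and its cyclic quotients\<close>

lemma regular_module_is_module:
  assumes "cring R"
  shows "Module.module R (regular_module R)"
proof -
  interpret cring R by fact
  have "\<exists>y\<in>carrier R. y \<oplus>\<^bsub>R\<^esub> x = \<zero>\<^bsub>R\<^esub>" if "x \<in> carrier R" for x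
    using that by (intro bexI[of _ "\<ominus>\<^bsub>R\<^esub> x"]) (auto simp: l_neg)
  then have "abelian_group (regular_module R)"
    by (intro abelian_groupI) (auto simp: regular_module_def a_ac)
  then show ?thesis
    by (intro moduleI) (auto simp: regular_module_def l_distr r_distr m_assoc cring_axioms)
qed

lemma regular_module_simps [simp]:
  "carrier (regular_module R) = carrier R" "a \<oplus>\<^bsub>regular_module R\<^esub> b = a \<oplus>\<^bsub>R\<^esub> b"
  "a \<odot>\<^bsub>regular_module R\<^esub> b = a \<otimes>\<^bsub>R\<^esub> b" "\<zero>\<^bsub>regular_module R\<^esub> = \<zero>\<^bsub>R\<^esub>"
  "\<ominus>\<^bsub>regular_module R\<^esub> a = \<ominus>\<^bsub>R\<^esub> a"
  by (simp_all add: regular_module_def a_inv_def m_inv_def)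

lemma cgenideal_submodule:
  assumes "cring R" "a \<in> carrier R"
  shows "Module.submodule (PIdl\<^bsub>R\<^esub> a) R (regular_module R)"
proof -
  interpret cring R by fact
  interpret ideal "PIdl\<^bsub>R\<^esub> a" R using assms(2) by (rule cgenideal_ideal)
  interpret M: module R "regular_module R" using assms(1) by (rule regular_module_is_module)
  show ?thesis
    by (rule M.submoduleI) (use a_subset in \<open>auto intro: I_l_closed\<close>)
qed

text \<open>\<open>laurent_ring\<close> abbreviates the same constant at type
  \<open>laurent\<close>, so results over \<open>base_ring\<close> specialise to it
  directly.\<close>

abbreviation base_ring :: "'k::comm_ring_1 ring" where "base_ring \<equiv> ring_of_type_algebra"

lemma ring_of_type_algebra_simps [simp]:
  "carrier base_ring = UNIV" "a \<oplus>\<^bsub>base_ring\<^esub> b = a + b" "a \<otimes>\<^bsub>base_ring\<^esub> b = a * b" "\<zero>\<^bsub>base_ring\<^esub> = 0" "\<one>\<^bsub>base_ring\<^esub> = 1"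
  by (simp_all add: ring_of_type_algebra_def)

lemma a_inv_ring_of_type_algebra [simp]: "\<ominus>\<^bsub>base_ring\<^esub> a = - a"
proof -
  interpret cring "base_ring :: 'a ring" by (rule cring_from_type_algebra)
  show ?thesis by (rule minus_equality) auto
qed

text \<open>Turns equality in k/(a) into divisibility, the form in which the coboundary conditions
  of degree 3 appear.\<close>

lemma principal_coset_eq_iff:
  fixes a :: "'k::comm_ring_1"
  shows "PIdl\<^bsub>base_ring\<^esub> a +>\<^bsub>regular_module base_ring\<^esub> x = PIdl\<^bsub>base_ring\<^esub> a +>\<^bsub>regular_module base_ring\<^esub> y \<longleftrightarrow> a dvd x - y"
  by (subst coset_eq_iff[OF regular_module_is_module cgenideal_submodule])
   (auto simp: cring_from_type_algebra cgenideal_def dvd_def mult.commute)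

section \<open>Linear maps on tensors\<close>

lemma lookup_scale [simp]: "Poly_Mapping.lookup (scale c x) w = c * Poly_Mapping.lookup x w"
  by (simp add: scale_def Poly_Mapping.map.rep_eq when_def)

text \<open>The linear functional, on the direct sum of all tensor powers, with prescribed values on
  basis words; cochains are its restrictions to one power.\<close>

definition lin_form :: "(letter list \<Rightarrow> 'k) \<Rightarrow> 'k::comm_ring_1 tensor \<Rightarrow> 'k" where
  "lin_form g x = (\<Sum>w \<in> Poly_Mapping.keys x. Poly_Mapping.lookup x w * g w)"

text \<open>Extra words have coefficient 0, so tensors with different supports can be summed over
  one common index set.\<close>

lemma lin_form_superset:
  assumes "finite S" "Poly_Mapping.keys x \<subseteq> S"
  shows "lin_form g x = (\<Sum>w \<in> S. Poly_Mapping.lookup x w * g w)"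
  unfolding lin_form_def using assms by (intro sum.mono_neutral_left) (auto simp: in_keys_iff)

lemma lin_form_zero [simp]: "lin_form g 0 = 0"
  by (simp add: lin_form_def)

lemma lin_form_basis [simp]: "lin_form g (basis w) = g w"
  by (simp add: lin_form_def)

lemma lin_form_add [simp]: "lin_form g (x + y) = lin_form g x + lin_form g y"
proof -
  let ?S = "Poly_Mapping.keys x \<union> Poly_Mapping.keys y"
  have "Poly_Mapping.keys (x + y) \<subseteq> ?S" by (rule Poly_Mapping.keys_add)
  then show ?thesis
    by (simp add: lin_form_superset[of ?S] lookup_add distrib_right sum.distrib)
qed

lemma lin_form_scale [simp]: "lin_form g (scale c x) = c * lin_form g x"
  by (subst lin_form_superset[of "Poly_Mapping.keys x"])
    (auto simp: lin_form_def in_keys_iff sum_distrib_left mult.assoc)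

lemma lin_form_diff [simp]: "lin_form g (x - y) = lin_form g x - lin_form g y"
  using lin_form_add[of g "x - y" y] by (simp add: algebra_simps del: lin_form_add)

lemma lin_form_sum [simp]: "lin_form g (sum x A) = (\<Sum>i\<in>A. lin_form g (x i))"
  by (induction A rule: infinite_finite_induct) auto

lemma lin_form_coeff_add: "lin_form (\<lambda>w. g w + h w) x = lin_form g x + lin_form h x"
  by (simp add: lin_form_def distrib_left sum.distrib)

lemma lin_form_coeff_scale: "lin_form (\<lambda>w. c * g w) x = c * lin_form g x"
  by (simp add: lin_form_def sum_distrib_left algebra_simps)

text \<open>Each coefficient of a linear extension is a linear form in the argument, so identities
  of tensors reduce to the rules for \<open>lin_form\<close>.\<close>

lemma lookup_linear_extension:
  "Poly_Mapping.lookup (linear_extension F x) v = lin_form (\<lambda>w. Poly_Mapping.lookup (F w) v) x"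
  by (simp add: linear_extension_def lin_form_def lookup_sum)

text \<open>Linearity on the whole type rather than on one tensor power: the maps here are built
  from \<open>linear_extension\<close>, so no degree conditions arise.\<close>

definition tensor_linear :: "('k::comm_ring_1 tensor \<Rightarrow> 'k tensor) \<Rightarrow> bool" where
  "tensor_linear f \<longleftrightarrow> (\<forall>x y. f (x + y) = f x + f y) \<and> (\<forall>c x. f (scale c x) = scale c (f x))"

lemma tensor_linearD:
  assumes "tensor_linear f"
  shows "f (x + y) = f x + f y" "f (scale c x) = scale c (f x)"
  using assms by (auto simp: tensor_linear_def)

lemma tensor_linear_linear_extension: "tensor_linear (linear_extension F)"
  by (auto simp: tensor_linear_def intro!: poly_mapping_eqI simp: lookup_linear_extension lookup_add)

lemmas linear_extension_add [simp] = tensor_linearD(1)[OF tensor_linear_linear_extension]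
lemmas linear_extension_scale [simp] = tensor_linearD(2)[OF tensor_linear_linear_extension]

lemma linear_extension_basis [simp]: "linear_extension F (basis w) = F w"
  by (rule poly_mapping_eqI) (simp add: lookup_linear_extension)

lemma linear_extension_zero [simp]: "linear_extension F 0 = 0"
  by (simp add: linear_extension_def)

lemma scale_one [simp]: "scale 1 x = x"
  and scale_zero [simp]: "scale c 0 = 0"
  and scale_scale [simp]: "scale c (scale d x) = scale (c * d) x"
  and scale_add: "scale c (x + y) = scale c x + scale c y"
  and scale_diff: "scale c (x - y) = scale c x - scale c y"
  by (auto intro!: poly_mapping_eqI simp: algebra_simps lookup_add lookup_minus)

lemma tensor_basis [simp]: "tensor (basis u) (basis v) = basis (u @ v)"
  by (simp add: tensor_def)

lemma tensor_add_left [simp]: "tensor (x + x') y = tensor x y + tensor x' y"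
  and tensor_scale_left [simp]: "tensor (scale c x) y = scale c (tensor x y)"
  and tensor_zero_left [simp]: "tensor 0 y = 0"
  by (simp_all add: tensor_def)

lemma lin_form_linear_extension: "lin_form g (linear_extension F x) = lin_form (\<lambda>w. lin_form g (F w)) x"
  by (simp add: linear_extension_def lin_form_def[of "\<lambda>w. lin_form g (F w)"])

lemma tensor_add_right [simp]: "tensor x (y + y') = tensor x y + tensor x y'"
  and tensor_scale_right [simp]: "tensor x (scale c y) = scale c (tensor x y)"
  and tensor_zero_right [simp]: "tensor x 0 = 0"
  by (auto intro!: poly_mapping_eqI simp: tensor_def lookup_linear_extension lookup_add
     lin_form_coeff_add lin_form_coeff_scale) (simp add: lin_form_def)

section \<open>Linearity of the faces and of the boundary\<close>

lemma tensor_linear_compose: "tensor_linear f \<Longrightarrow> tensor_linear g \<Longrightarrow> tensor_linear (f \<circ> g)"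
  by (simp add: tensor_linear_def)

lemma tensor_linear_tensor_map: "tensor_linear (tensor_map p f g)"
  by (simp add: tensor_map_def tensor_linear_linear_extension)

lemma tensor_linear_R_at: "tensor_linear (R_at y j)"
  by (simp add: R_at_def tensor_linear_tensor_map)

lemma tensor_linear_foldr:
  "(\<And>f. f \<in> set fs \<Longrightarrow> tensor_linear f) \<Longrightarrow> tensor_linear (foldr (\<circ>) fs id)"
  by (induction fs) (auto intro: tensor_linear_compose, simp add: tensor_linear_def)

lemma tensor_linear_left_face: "tensor_linear (left_face y i)"
  unfolding left_face_def
  by (auto intro!: tensor_linear_compose tensor_linear_tensor_map tensor_linear_foldr tensor_linear_R_at)

lemma tensor_linear_right_face: "tensor_linear (right_face y n i)"
  unfolding right_face_def
  by (auto intro!: tensor_linear_compose tensor_linear_tensor_map tensor_linear_foldr tensor_linear_R_at)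

lemma tensor_linear_boundary: "tensor_linear (boundary y n)"
proof -
  have "scale c (sum f A) = (\<Sum>i\<in>A. scale c (f i))" for c :: 'a and f and A :: "nat set"
    by (induction A rule: infinite_finite_induct) (auto simp: scale_add)
  then show ?thesis
    by (auto simp: tensor_linear_def boundary_def tensor_linearD[OF tensor_linear_left_face]
      tensor_linearD[OF tensor_linear_right_face] scale_add scale_diff sum.distrib sum_subtractf
      mult.commute[of "_ ^ _"])
qed

section \<open>Evaluation of the faces on basis words\<close>

lemmas R_at_linear [simp] = tensor_linearD[OF tensor_linear_R_at]

lemma R_at_basis:
  "R_at y j (basis w) = tensor (basis (take j w))
     (tensor (R_basis y (take 2 (drop j w))) (basis (drop 2 (drop j w))))"
  by (simp add: R_at_def tensor_map_def YB_R_def)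

lemmas left_mu_linear [simp] = tensor_linearD[OF tensor_linear_tensor_map]

text \<open>Stated with \<open>Suc 0\<close>, the simp normal form of the 1 in
  \<open>left_face\<close>.\<close>

lemma left_mu_basis [simp]:
  "tensor_map (Suc 0) mu id (basis (a # w)) = basis w"
  by (cases a) (auto simp: tensor_map_def mu_def)

lemma right_mu_basis [simp]:
  "length w = n \<Longrightarrow> tensor_map n id mu (basis (w @ [a])) = basis w"
  by (cases a) (auto simp: tensor_map_def mu_def)

text \<open>An explicit list such as \<open>[E1, E2, E1]\<close> does not match the pattern
  \<open>w @ [a]\<close>; \<open>butlast\<close> can be computed on it.\<close>

lemma right_mu_basis_concrete:
  "length w = Suc n \<Longrightarrow> tensor_map n id mu (basis w) = basis (butlast w)"
  using right_mu_basis[of "butlast w" n "last w"] by (cases w rule: rev_cases) auto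

section \<open>Degrees of tensors\<close>

lemma tensor_power_carrier:
  "x \<in> carrier (tensor_power n) \<longleftrightarrow> (\<forall>w\<in>Poly_Mapping.keys x. length w = n)"
  by (simp add: tensor_power_def)

lemma
  shows zero_in_tensor_power [simp]: "0 \<in> carrier (tensor_power n)"
    and basis_in_tensor_power: "length w = n \<Longrightarrow> basis w \<in> carrier (tensor_power n)"
    and add_in_tensor_power: "x \<in> carrier (tensor_power n) \<Longrightarrow> y \<in> carrier (tensor_power n)
        \<Longrightarrow> x + y \<in> carrier (tensor_power n)"
    and scale_in_tensor_power: "x \<in> carrier (tensor_power n) \<Longrightarrow> scale c x \<in> carrier (tensor_power n)"
    and diff_in_tensor_power: "x \<in> carrier (tensor_power n) \<Longrightarrow> y \<in> carrier (tensor_power n)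
        \<Longrightarrow> x - y \<in> carrier (tensor_power n)"
  unfolding tensor_power_carrier
  by (auto simp: in_keys_iff split: if_splits dest: Poly_Mapping.keys_add[THEN subsetD] keys_diff[THEN subsetD])

lemma sum_in_tensor_power:
  "(\<And>i. i \<in> A \<Longrightarrow> f i \<in> carrier (tensor_power n)) \<Longrightarrow> sum f A \<in> carrier (tensor_power n)"
  by (induction A rule: infinite_finite_induct) (auto intro: add_in_tensor_power)

lemma linear_extension_in_tensor_power:
  assumes "\<And>w. length w = n \<Longrightarrow> F w \<in> carrier (tensor_power m)" "x \<in> carrier (tensor_power n)"
  shows "linear_extension F x \<in> carrier (tensor_power m)"
  unfolding linear_extension_def using assms
  by (intro sum_in_tensor_power scale_in_tensor_power) (use assms in \<open>auto simp: tensor_power_carrier\<close>)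

lemma tensor_in_tensor_power:
  assumes "x \<in> carrier (tensor_power m)" "y \<in> carrier (tensor_power n)"
  shows "tensor x y \<in> carrier (tensor_power (m + n))"
  unfolding tensor_def
  by (rule linear_extension_in_tensor_power[OF linear_extension_in_tensor_power[OF _ assms(2)] assms(1)])
    (simp add: basis_in_tensor_power)

lemma R_basis_in_tensor_power: "R_basis y w \<in> carrier (tensor_power 2)"
  by (induction y w rule: R_basis.induct)
   (auto intro!: add_in_tensor_power scale_in_tensor_power basis_in_tensor_power)

lemma R_at_in_tensor_power:
  assumes "j + 2 \<le> n" "x \<in> carrier (tensor_power n)"
  shows "R_at y j x \<in> carrier (tensor_power n)"
proof -
  \<comment> \<open>With the j untouched letters split off, \<open>R\<close> acts on the first two
    of the remaining n - j = 2 + m factors.\<close>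
  have "tensor_map 2 (YB_R y) id x \<in> carrier (tensor_power (2 + m))"
    if "x \<in> carrier (tensor_power (2 + m))" for m and x :: "'a tensor"
    unfolding tensor_map_def
    by (rule linear_extension_in_tensor_power[OF tensor_in_tensor_power that])
      (simp_all add: basis_in_tensor_power R_basis_in_tensor_power YB_R_def)
  moreover obtain m where "n - j = 2 + m"
    using assms(1) by (metis le_add_diff_inverse le_diff_conv2 add.commute add_leD1)
  ultimately have *: "tensor_map 2 (YB_R y) id x \<in> carrier (tensor_power (n - j))"
    if "x \<in> carrier (tensor_power (n - j))" for x :: "'a tensor"
    using that by simp
  have "R_at y j x \<in> carrier (tensor_power (j + (n - j)))"
    unfolding R_at_def tensor_map_def[of j]
    by (rule linear_extension_in_tensor_power[OF tensor_in_tensor_power assms(2)])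
      (use assms(1) in \<open>simp_all add: basis_in_tensor_power *\<close>)
  then show ?thesis using assms by simp
qed

lemma foldr_in_tensor_power:
  "(\<And>f x. f \<in> set fs \<Longrightarrow> x \<in> carrier (tensor_power n) \<Longrightarrow> f x \<in> carrier (tensor_power n)) \<Longrightarrow>
    x \<in> carrier (tensor_power n) \<Longrightarrow> foldr (\<circ>) fs id x \<in> carrier (tensor_power n)"
  by (induction fs) auto

lemma mu_in_tensor_power:
  assumes "x \<in> carrier (tensor_power (Suc n))"
  shows "tensor_map 1 mu id x \<in> carrier (tensor_power n)"
    "tensor_map n id mu x \<in> carrier (tensor_power n)"
proof -
  have mu: "mu_basis w \<in> carrier (tensor_power 0)" for w
    by (induction w rule: mu_basis.induct) (auto intro: basis_in_tensor_power)
  \<comment> \<open>The degrees 0 + n and n + 0 keep the shape that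
    \<open>tensor_in_tensor_power\<close> produces.\<close>
  have "tensor_map 1 mu id x \<in> carrier (tensor_power (0 + n))"
    "tensor_map n id mu x \<in> carrier (tensor_power (n + 0))"
    unfolding tensor_map_def mu_def
    by (rule linear_extension_in_tensor_power[OF tensor_in_tensor_power assms];
      simp add: basis_in_tensor_power mu)+
  then show "tensor_map 1 mu id x \<in> carrier (tensor_power n)"
    "tensor_map n id mu x \<in> carrier (tensor_power n)" by simp_all
qed

lemma boundary_in_tensor_power:
  assumes "x \<in> carrier (tensor_power (Suc n))"
  shows "boundary y (Suc n) x \<in> carrier (tensor_power n)"
  unfolding boundary_def left_face_def right_face_def diff_Suc_1 o_apply[of "tensor_map _ _ _"]
  by (intro sum_in_tensor_power scale_in_tensor_power diff_in_tensor_power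
     mu_in_tensor_power foldr_in_tensor_power assms)
    (auto intro!: R_at_in_tensor_power)

text \<open>The coboundary in coordinates: the value on the word \<open>w\<close> of the coboundary
  of the cochain with values \<open>g\<close>.\<close>

definition coface :: "'k \<Rightarrow> nat \<Rightarrow> (letter list \<Rightarrow> 'k) \<Rightarrow> letter list \<Rightarrow> 'k::comm_ring_1" where
  "coface y n g w = lin_form g (boundary y n (basis w))"

text \<open>Rules by which the simplifier computes a coface on an explicit word;
  \<open>upt_rec\<close> unrolls the ranges of positions at which \<open>R\<close> acts.\<close>

lemmas boundary_eval = coface_def boundary_def left_face_def right_face_def numeral_eq_Suc
  R_at_basis right_mu_basis_concrete upt_rec

section \<open>Cochains as functions on words\<close>

lemma linear_extension_basis_id: "linear_extension basis x = x"
  by (rule poly_mapping_eqI)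
   (simp add: lookup_linear_extension lin_form_def lookup_single when_def in_keys_iff if_distrib sum.delta cong: if_cong)

text \<open>The restriction supplies the extensionality required by \<open>dual_module\<close>; only
  the values of \<open>g\<close> on words of length n survive.\<close>

definition cochain :: "nat \<Rightarrow> (letter list \<Rightarrow> 'k) \<Rightarrow> 'k::comm_ring_1 tensor \<Rightarrow> 'k" where
  "cochain n g = restrict (lin_form g) (carrier (tensor_power n))"

lemma tensor_power_simps [simp]:
  "a \<oplus>\<^bsub>tensor_power n\<^esub> b = a + b" "c \<odot>\<^bsub>tensor_power n\<^esub> b = scale c b"
  by (simp_all add: tensor_power_def)

lemma cochain_eq_iff:
  fixes g h :: "letter list \<Rightarrow> 'k::comm_ring_1"
  shows "cochain n g = cochain n h \<longleftrightarrow> (\<forall>w. length w = n \<longrightarrow> g w = h w)"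
proof
  assume eq: "cochain n g = cochain n h"
  have "g w = h w" if "length w = n" for w
    using fun_cong[OF eq, of "basis w"]
    by (simp add: cochain_def basis_in_tensor_power that)
  then show "\<forall>w. length w = n \<longrightarrow> g w = h w" by blast
next
  assume "\<forall>w. length w = n \<longrightarrow> g w = h w"
  then show "cochain n g = cochain n h"
    by (auto simp: cochain_def lin_form_def tensor_power_carrier intro!: restrict_ext sum.cong)
qed

lemma func_space_K_simps:
  "carrier (ring.func_space base_ring S) = S \<rightarrow>\<^sub>E (UNIV :: 'k::comm_ring_1 set)"
  "f \<oplus>\<^bsub>ring.func_space (base_ring :: 'k ring) S\<^esub> g = restrict (\<lambda>x. f x + g x) S"
  "c \<odot>\<^bsub>ring.func_space (base_ring :: 'k ring) S\<^esub> g = restrict (\<lambda>x. c * g x) S"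
  "\<zero>\<^bsub>ring.func_space (base_ring :: 'k ring) S\<^esub> = restrict (\<lambda>x. 0) S"
  by (simp_all add: ring.func_space_def[OF ring_from_type_algebra])

text \<open>A homomorphism on a free module is determined by its values on the basis, and these are
  arbitrary. From here on cochains are functions on words.\<close>

lemma cochain_module_carrier: "carrier (cochain_module n) = range (cochain n)"
proof (intro equalityI subsetI)
  fix f :: "'a tensor \<Rightarrow> 'a" assume "f \<in> carrier (cochain_module n)"
  then have hom: "f \<in> module_hom base_ring (tensor_power n) (regular_module base_ring)"
    and ext: "f \<in> extensional (carrier (tensor_power n))"
    by (auto simp: cochain_module_def dual_module_def)
  have sum: "f (\<Sum>w\<in>A. scale (c w) (basis w)) = (\<Sum>w\<in>A. c w * f (basis w))"
    if "finite A" "\<And>w. w \<in> A \<Longrightarrow> length w = n" for A and c :: "letter list \<Rightarrow> 'a"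
    using that
  proof (induction A)
    case empty
    \<comment> \<open>Since 0 = 0 * 0 as a scalar multiple, homogeneity alone gives f 0 = 0.\<close>
    show ?case using module_hom_smult[OF hom, of 0 0] by simp
  next
    case (insert w A)
    then show ?case
      using module_hom_add[OF hom, of "scale (c w) (basis w)" "\<Sum>w\<in>A. scale (c w) (basis w)"]
        module_hom_smult[OF hom, of "c w" "basis w"]
      by (simp add: basis_in_tensor_power scale_in_tensor_power sum_in_tensor_power)
  qed
  have "f x = cochain n (\<lambda>w. f (basis w)) x" for x
  proof (cases "x \<in> carrier (tensor_power n)")
    case True
    then show ?thesis
      using sum[of "Poly_Mapping.keys x" "Poly_Mapping.lookup x"] linear_extension_basis_id[of x]
      by (simp add: cochain_def lin_form_def linear_extension_def tensor_power_carrier)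
  next
    case False
    then show ?thesis using ext by (simp add: cochain_def extensional_def)
  qed
  then show "f \<in> range (cochain n)" by blast
next
  fix f :: "'a tensor \<Rightarrow> 'a" assume "f \<in> range (cochain n)"
  then show "f \<in> carrier (cochain_module n)"
    by (auto simp: cochain_module_def dual_module_def module_hom_def cochain_def
      add_in_tensor_power scale_in_tensor_power)
qed

lemma cochain_add: "cochain n g \<oplus>\<^bsub>cochain_module n\<^esub> cochain n h = cochain n (\<lambda>w. g w + h w)"
  by (auto simp: cochain_module_def dual_module_def func_space_K_simps cochain_def lin_form_coeff_add
      intro!: restrict_ext)

lemma cochain_smult: "c \<odot>\<^bsub>cochain_module n\<^esub> cochain n g = cochain n (\<lambda>w. c * g w)"
  by (auto simp: cochain_module_def dual_module_def func_space_K_simps cochain_def lin_form_coeff_scale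
      intro!: restrict_ext)

lemma cochain_zero: "\<zero>\<^bsub>cochain_module n\<^esub> = cochain n (\<lambda>w. 0)"
  by (auto simp: cochain_module_def dual_module_def func_space_K_simps cochain_def lin_form_def
      intro!: restrict_ext)

text \<open>The module axioms are inherited from the module of all functions on the tensor power,
  whose operations the cochains share. It is applied to the cocycles.\<close>

lemma cochain_submodule:
  assumes "S \<noteq> {}" "\<And>g h. g \<in> S \<Longrightarrow> h \<in> S \<Longrightarrow> (\<lambda>w. g w + h w) \<in> S"
    and smult: "\<And>c g. g \<in> S \<Longrightarrow> (\<lambda>w. c * g w) \<in> S"
  shows "Module.module base_ring ((cochain_module n) \<lparr>carrier := cochain n ` S\<rparr>)"
proof -
  let ?F = "ring.func_space (base_ring :: 'a ring) (carrier (tensor_power n))"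
  have mod: "Module.module base_ring ?F" by (rule cring.func_space_is_module[OF cring_from_type_algebra])
  have dual: "cochain_module n = ?F \<lparr>carrier := carrier (cochain_module n)\<rparr>"
    by (simp add: cochain_module_def dual_module_def)
  have op: "\<zero>\<^bsub>?F\<^esub> = \<zero>\<^bsub>cochain_module n\<^esub>" "f \<oplus>\<^bsub>?F\<^esub> g = f \<oplus>\<^bsub>cochain_module n\<^esub> g"
    "c \<odot>\<^bsub>?F\<^esub> f = c \<odot>\<^bsub>cochain_module n\<^esub> f" for f g c
    by (simp_all add: cochain_module_def dual_module_def)
  obtain g where "g \<in> S" using assms(1) by blast
  from smult[OF this, of 0] have "(\<lambda>w. 0) \<in> S" by simp
  then have "Module.submodule (cochain n ` S) base_ring ?F"
    by (intro submoduleI_smult[OF mod])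
      (auto simp: op cochain_zero cochain_add cochain_smult assms, auto simp: cochain_def func_space_K_simps)
  from Module.submodule.submodule_is_module[OF this mod] show ?thesis
    by (subst dual) simp
qed

text \<open>Both sides are linear in the tensor, so agreement on basis words suffices; there it is
  the definition of \<open>coface\<close>.\<close>

lemma coboundary_cochain: "coboundary y (Suc n) (cochain n g) = cochain (Suc n) (coface y (Suc n) g)"
proof -
  have "lin_form g (boundary y (Suc n) x) = lin_form (coface y (Suc n) g) x" for x
  proof -
    have "boundary y (Suc n) x = linear_extension (\<lambda>w. boundary y (Suc n) (basis w)) x"
    proof -
      have 0: "boundary y (Suc n) 0 = 0"
        using tensor_linearD(1)[OF tensor_linear_boundary, of y "Suc n" 0 0] by simp
      have "boundary y (Suc n) (sum f A) = (\<Sum>i\<in>A. boundary y (Suc n) (f i))" for f and A :: "letter list set"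
        by (induction A rule: infinite_finite_induct) (auto simp: 0 tensor_linearD[OF tensor_linear_boundary])
      then have "boundary y (Suc n) (linear_extension basis x) = linear_extension (\<lambda>w. boundary y (Suc n) (basis w)) x"
        by (simp add: linear_extension_def tensor_linearD[OF tensor_linear_boundary])
      then show ?thesis by (simp add: linear_extension_basis_id)
    qed
    then show ?thesis by (simp add: lin_form_linear_extension coface_def[abs_def])
  qed
  then show ?thesis
    by (auto simp: coboundary_def cochain_def boundary_in_tensor_power intro!: restrict_ext)
qed

section \<open>Cohomology in coordinates\<close>

definition cocycles :: "'k \<Rightarrow> nat \<Rightarrow> (letter list \<Rightarrow> 'k::comm_ring_1) set" where
  "cocycles y n = {g. \<forall>w. length w = Suc n \<longrightarrow> coface y (Suc n) g w = 0}"

lemma a_kernel_coboundary: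
  "a_kernel (cochain_module n) (cochain_module (Suc n)) (coboundary y (Suc n)) = cochain n ` cocycles y n"
  by (auto simp: a_kernel_def' cochain_module_carrier coboundary_cochain cochain_zero cochain_eq_iff cocycles_def)

text \<open>Reduces the computation of a cohomology module to a map \<open>\<Phi>\<close> on
  functions on words that is onto on cocycles and has the coboundaries as kernel. That coboundaries
  are cocycles enters as \<open>cob\<close>, which the explicit formulas settle in each
  degree.\<close>

theorem YB_cohomology_isomorphic:
  fixes y :: "'k::comm_ring_1"
    and \<Phi> :: "(letter list \<Rightarrow> 'k) \<Rightarrow> 't"
  assumes cong: "\<And>g h. (\<And>w. length w = Suc n \<Longrightarrow> g w = h w) \<Longrightarrow> \<Phi> g = \<Phi> h"
    and add: "\<And>g h. \<Phi> (\<lambda>w. g w + h w) = \<Phi> g \<oplus>\<^bsub>T\<^esub> \<Phi> h"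
    and smult: "\<And>c g. \<Phi> (\<lambda>w. c * g w) = c \<odot>\<^bsub>T\<^esub> \<Phi> g"
    and surj: "\<Phi> ` cocycles y (Suc n) = carrier T"
    and cob: "\<And>h. coface y (Suc n) h \<in> cocycles y (Suc n)"
    and ker: "\<And>g. g \<in> cocycles y (Suc n) \<Longrightarrow>
      \<Phi> g = \<Phi> (\<lambda>w. 0) \<longleftrightarrow> (\<exists>h. \<forall>w. length w = Suc n \<longrightarrow> g w = coface y (Suc n) h w)"
  shows "module_isomorphic base_ring (YB_cohomology y (Suc n)) T"
proof -
  let ?Z = "(cochain_module (Suc n)) \<lparr>carrier := cochain (Suc n) ` cocycles y (Suc n)\<rparr>"
  let ?B = "coboundary y (Suc n) ` carrier (cochain_module n)"
  have cocycle: "(\<lambda>w. 0) \<in> cocycles y (Suc n)"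
    "\<And>g h. g \<in> cocycles y (Suc n) \<Longrightarrow> h \<in> cocycles y (Suc n) \<Longrightarrow> (\<lambda>w. g w + h w) \<in> cocycles y (Suc n)"
    "\<And>c g. g \<in> cocycles y (Suc n) \<Longrightarrow> (\<lambda>w. c * g w) \<in> cocycles y (Suc n)"
    using lin_form_coeff_scale[of 0 "\<lambda>w. 0"]
    by (auto simp: cocycles_def coface_def lin_form_coeff_add lin_form_coeff_scale)
  have mod: "Module.module base_ring ?Z" using cocycle by (intro cochain_submodule) blast+
  \<comment> \<open>\<open>\<phi>\<close> reads the coordinates back off a cochain. On words of
    another length the cochain is \<open>undefined\<close>, and \<open>cong\<close> makes
    \<open>\<Phi>\<close> blind to those values.\<close>
  define \<phi> where "\<phi> f = \<Phi> (\<lambda>w. f (basis w))" for f :: "'k tensor \<Rightarrow> 'k"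
  have \<phi>: "\<phi> (cochain (Suc n) g) = \<Phi> g" for g
    unfolding \<phi>_def by (rule cong) (simp add: cochain_def basis_in_tensor_power)
  have \<Phi>_in: "\<Phi> g \<in> carrier T" if "g \<in> cocycles y (Suc n)" for g using that surj by blast
  have "\<phi> \<in> module_hom base_ring ?Z T"
    by (auto simp: module_hom_def \<phi> \<Phi>_in cochain_add cochain_smult add smult)
  moreover have "\<phi> ` carrier ?Z = carrier T"
    by (simp add: image_image \<phi> surj)
  moreover have "?B = {f \<in> carrier ?Z. \<phi> f = \<phi> \<zero>\<^bsub>?Z\<^esub>}"
  proof -
    have "?B = (\<lambda>h. cochain (Suc n) (coface y (Suc n) h)) ` UNIV"
      by (simp add: cochain_module_carrier image_image coboundary_cochain)
    also have "\<dots> = {cochain (Suc n) g |g. g \<in> cocycles y (Suc n) \<and> \<Phi> g = \<Phi> (\<lambda>w. 0)}"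
    proof (intro equalityI subsetI)
      fix x assume "x \<in> range (\<lambda>h. cochain (Suc n) (coface y (Suc n) h))"
      then obtain h where "x = cochain (Suc n) (coface y (Suc n) h)" by blast
      moreover have "\<Phi> (coface y (Suc n) h) = \<Phi> (\<lambda>w. 0)" using ker[OF cob] by blast
      ultimately show "x \<in> {cochain (Suc n) g |g. g \<in> cocycles y (Suc n) \<and> \<Phi> g = \<Phi> (\<lambda>w. 0)}"
        using cob by blast
    next
      fix x assume "x \<in> {cochain (Suc n) g |g. g \<in> cocycles y (Suc n) \<and> \<Phi> g = \<Phi> (\<lambda>w. 0)}"
      then obtain g where g: "x = cochain (Suc n) g" "g \<in> cocycles y (Suc n)" "\<Phi> g = \<Phi> (\<lambda>w. 0)"
        by blast
      then obtain h where "\<forall>w. length w = Suc n \<longrightarrow> g w = coface y (Suc n) h w" using ker by blast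
      then have "x = cochain (Suc n) (coface y (Suc n) h)" unfolding g(1) cochain_eq_iff .
      then show "x \<in> range (\<lambda>h. cochain (Suc n) (coface y (Suc n) h))" by blast
    qed
    also have "\<dots> = {f \<in> carrier ?Z. \<phi> f = \<phi> \<zero>\<^bsub>?Z\<^esub>}"
      by (auto simp: cochain_zero \<phi>)
    finally show ?thesis .
  qed
  ultimately have "module_isomorphic base_ring (quotient_module ?Z ?B) T"
    by (rule quotient_module_isomorphic[OF mod])
  then show ?thesis by (simp add: YB_cohomology_def a_kernel_coboundary)
qed

section \<open>Degrees two and three\<close>

text \<open>\<open>R\<close> sends a two-letter word to a combination of words with the same letters
  and coefficient sum 1. Deleting the first and the last letter therefore yields the sum of both
  letters, which cancels the two faces without \<open>R\<close>.\<close>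

lemma coface_2: "length w = 2 \<Longrightarrow> coface y 2 g w = 0"
proof -
  assume "length w = 2"
  then obtain a b where "w = [a, b]" by (auto simp: numeral_eq_Suc length_Suc_conv)
  then show ?thesis by (cases a; cases b) (simp_all add: boundary_eval algebra_simps)
qed

text \<open>The two nonzero values are multiples of 1 - y^2, and their sum is (1 - y^4) times
  \<open>g [E1,E1] - g [E2,E2]\<close>: the source of the two torsion summands.\<close>

lemma coface_3:
  "coface y 3 g [E1,E1,E1] = 0" "coface y 3 g [E1,E2,E1] = 0"
  "coface y 3 g [E2,E1,E1] = 0" "coface y 3 g [E2,E1,E2] = 0"
  "coface y 3 g [E2,E2,E1] = 0" "coface y 3 g [E2,E2,E2] = 0"
  "coface y 3 g [E1,E1,E2] = (1 - y^2) * ((1 + y^2) * g [E1,E1] - g [E1,E2] - y^2 * g [E2,E1])"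
  "coface y 3 g [E1,E2,E2] = (1 - y^2) * (g [E1,E2] + y^2 * g [E2,E1] - (1 + y^2) * g [E2,E2])"
  by (simp_all add: boundary_eval algebra_simps)

text \<open>The values \<open>g [E1,E1,E2]\<close> and \<open>g [E1,E2,E2]\<close> occur nowhere on
  the right, so cocycles leave them free.\<close>

lemma coface_4:
  "coface y 4 g [E1,E1,E1,E1] = 0"
  "coface y 4 g [E1,E1,E1,E2] = y^2 * (1 - y^2) * (g [E1,E2,E1] + y^2 * g [E2,E1,E1] - (1 + y^2) * g [E1,E1,E1])"
  "coface y 4 g [E1,E1,E2,E1] = (1 - y^2) * ((1 + y^2) * g [E1,E1,E1] - g [E1,E2,E1] - y^2 * g [E2,E1,E1])"
  "coface y 4 g [E1,E1,E2,E2] = 0"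
  "coface y 4 g [E1,E2,E1,E1] = 0"
  "coface y 4 g [E1,E2,E1,E2] = y^2 * (1 - y^2) * (g [E2,E1,E1] + g [E2,E2,E1] - g [E1,E2,E1] - g [E2,E1,E2])"
  "coface y 4 g [E1,E2,E2,E1] = (1 - y^2) * (g [E1,E2,E1] + y^2 * g [E2,E1,E1] - (1 + y^2) * g [E2,E2,E1])"
  "coface y 4 g [E1,E2,E2,E2] = y^2 * (1 - y^2) * (g [E2,E1,E2] + y^2 * g [E2,E2,E1] - (1 + y^2) * g [E2,E2,E2])"
  "coface y 4 g [E2,E1,E1,E1] = 0"
  "coface y 4 g [E2,E1,E1,E2] = (1 - y^2) * (g [E2,E1,E2] + y^2 * g [E2,E2,E1] - (1 + y^2) * g [E2,E1,E1])"
  "coface y 4 g [E2,E1,E2,E1] = 0"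
  "coface y 4 g [E2,E1,E2,E2] = (1 - y^2) * ((1 + y^2) * g [E2,E2,E2] - g [E2,E1,E2] - y^2 * g [E2,E2,E1])"
  "coface y 4 g [E2,E2,E1,E1] = 0" "coface y 4 g [E2,E2,E1,E2] = 0"
  "coface y 4 g [E2,E2,E2,E1] = 0" "coface y 4 g [E2,E2,E2,E2] = 0"
  by (simp_all add: boundary_eval algebra_simps)

text \<open>Peels off one letter, so that a statement about all words of a fixed length unfolds into
  a finite conjunction.\<close>

lemma all_words_Suc:
  "(\<forall>w. length w = Suc n \<longrightarrow> P w) \<longleftrightarrow> (\<forall>w. length w = n \<longrightarrow> P (E1 # w) \<and> P (E2 # w))"
proof (intro iffI allI impI)
  fix w :: "letter list"
  assume all: "\<forall>w. length w = n \<longrightarrow> P (E1 # w) \<and> P (E2 # w)" and "length w = Suc n"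
  then obtain a v where "w = a # v" "length v = n" by (cases w) auto
  with all have "w = a # v" "P (E1 # v)" "P (E2 # v)" by blast+
  then show "P w" by (cases a) simp_all
qed simp_all

lemma all_words_numeral:
  "(\<forall>w. length w = numeral k \<longrightarrow> P w) \<longleftrightarrow>
   (\<forall>w. length w = pred_numeral k \<longrightarrow> P (E1 # w) \<and> P (E2 # w))"
  by (simp add: numeral_eq_Suc all_words_Suc)

lemmas all_words = all_words_numeral all_words_Suc

lemma one_minus_power4: "1 - y ^ 4 = (1 - y^2) * (1 + y^2)"
  for y :: "'k::comm_ring_1"
  by (simp add: algebra_simps flip: power_add)

text \<open>Both 1 - y^2 and 1 + y^2 are nonzero, as their product is 1 - y^4. The first is
  cancelled from the formulas of \<open>coface_3\<close>, the second after the value at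
  \<open>[E1,E2]\<close> has been eliminated.\<close>

lemma cocycles_2:
  fixes y :: "'k::idom"
  assumes y: "y ^ 4 \<noteq> 1"
  shows "g \<in> cocycles y 2 \<longleftrightarrow>
    g [E1,E2] = (1 + y^2) * g [E1,E1] - y^2 * g [E2,E1] \<and> g [E2,E2] = g [E1,E1]"
proof -
  have nz: "1 - y^2 \<noteq> 0" "1 + y^2 \<noteq> 0"
    using y one_minus_power4[of y] by auto
  have "g \<in> cocycles y 2 \<longleftrightarrow> (1 + y^2) * g [E1,E1] - g [E1,E2] - y^2 * g [E2,E1] = 0 \<and>
     g [E1,E2] + y^2 * g [E2,E1] - (1 + y^2) * g [E2,E2] = 0"
    using nz(1) by (simp add: cocycles_def all_words coface_3 flip: numeral_3_eq_3)
  also have "\<dots> \<longleftrightarrow> g [E1,E2] = (1 + y^2) * g [E1,E1] - y^2 * g [E2,E1] \<and>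
     (1 + y^2) * g [E2,E2] = (1 + y^2) * g [E1,E1]"
    by (auto simp: algebra_simps)
  finally show ?thesis using nz(2) by simp
qed

text \<open>The four words \<open>[E1,E1,E2,E1]\<close>, \<open>[E1,E2,E2,E1]\<close>,
  \<open>[E2,E1,E1,E2]\<close>, \<open>[E2,E1,E2,E2]\<close>, whose cofaces carry the bare factor 1
  - y^2, already give all relations; y itself is never cancelled.\<close>

lemma cocycles_3:
  fixes y :: "'k::idom"
  assumes y: "y ^ 4 \<noteq> 1"
  shows "g \<in> cocycles y 3 \<longleftrightarrow>
    g [E1,E2,E1] = (1 + y^2) * g [E1,E1,E1] - y^2 * g [E2,E1,E1] \<and>
    g [E2,E1,E2] = (1 + y^2) * g [E2,E1,E1] - y^2 * g [E1,E1,E1] \<and>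
    g [E2,E2,E1] = g [E1,E1,E1] \<and> g [E2,E2,E2] = g [E2,E1,E1]"
    (is "_ \<longleftrightarrow> ?eqs")
proof -
  have nz: "1 - y^2 \<noteq> 0" "1 + y^2 \<noteq> 0"
    using y one_minus_power4[of y] by auto
  show ?thesis
  proof
    assume "g \<in> cocycles y 3"
    then have "\<forall>w. length w = 4 \<longrightarrow> coface y 4 g w = 0" by (simp add: cocycles_def)
    then have 1: "(1 + y^2) * g [E1,E1,E1] - g [E1,E2,E1] - y^2 * g [E2,E1,E1] = 0"
      and 2: "g [E1,E2,E1] + y^2 * g [E2,E1,E1] - (1 + y^2) * g [E2,E2,E1] = 0"
      and 3: "g [E2,E1,E2] + y^2 * g [E2,E2,E1] - (1 + y^2) * g [E2,E1,E1] = 0"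
      and 4: "(1 + y^2) * g [E2,E2,E2] - g [E2,E1,E2] - y^2 * g [E2,E2,E1] = 0"
      using nz(1) by (simp_all add: all_words coface_4)
    have 121: "g [E1,E2,E1] = (1 + y^2) * g [E1,E1,E1] - y^2 * g [E2,E1,E1]"
      and 212: "g [E2,E1,E2] = (1 + y^2) * g [E2,E1,E1] - y^2 * g [E2,E2,E1]"
      using 1 3 by (auto simp: algebra_simps)
    have "(1 + y^2) * g [E2,E2,E1] = (1 + y^2) * g [E1,E1,E1]" using 2 121 by auto
    moreover have "(1 + y^2) * g [E2,E2,E2] = (1 + y^2) * g [E2,E1,E1]" using 4 212 by auto
    ultimately have "g [E2,E2,E1] = g [E1,E1,E1]" "g [E2,E2,E2] = g [E2,E1,E1]" using nz(2) by auto
    with 121 212 show ?eqs by simp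
  next
    assume ?eqs
    then have eq: "g [E1,E2,E1] = (1 + y^2) * g [E1,E1,E1] - y^2 * g [E2,E1,E1]"
      "g [E2,E1,E2] = (1 + y^2) * g [E2,E1,E1] - y^2 * g [E1,E1,E1]"
      "g [E2,E2,E1] = g [E1,E1,E1]" "g [E2,E2,E2] = g [E2,E1,E1]"
      by blast+
    \<comment> \<open>The relation from the word \<open>[E1,E2,E1,E2]\<close> is a consequence of
      the others.\<close>
    have "g [E2,E1,E1] + g [E2,E2,E1] - g [E1,E2,E1] - g [E2,E1,E2] = 0"
      unfolding eq by (simp add: algebra_simps)
    then have "\<forall>w. length w = 4 \<longrightarrow> coface y 4 g w = 0"
      by (simp add: all_words coface_4 eq)
    then show "g \<in> cocycles y 3" by (simp add: cocycles_def)
  qed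
qed

section \<open>The cohomology modules in degrees two and three\<close>

lemma direct_sum_simps:
  "carrier (direct_sum M N) = carrier M \<times> carrier N"
  "(a, b) \<oplus>\<^bsub>direct_sum M N\<^esub> (a', b') = (a \<oplus>\<^bsub>M\<^esub> a', b \<oplus>\<^bsub>N\<^esub> b')"
  "c \<odot>\<^bsub>direct_sum M N\<^esub> (a, b) = (c \<odot>\<^bsub>M\<^esub> a, c \<odot>\<^bsub>N\<^esub> b)"
  by (simp_all add: direct_sum_def)

theorem YB_cohomology_2:
  fixes y :: "'k::idom"
  assumes y: "y ^ 4 \<noteq> 1"
  shows "module_isomorphic base_ring (YB_cohomology y 2)
    (direct_sum (regular_module base_ring) (regular_module base_ring))"
proof -
  define \<Phi> :: "(letter list \<Rightarrow> 'k) \<Rightarrow> 'k \<times> 'k" where "\<Phi> g = (g [E1,E1], g [E2,E1])" for g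
  have "module_isomorphic base_ring (YB_cohomology y (Suc 1))
    (direct_sum (regular_module base_ring) (regular_module base_ring))"
  proof (rule YB_cohomology_isomorphic[where \<Phi>=\<Phi>], unfold Suc_1)
    have "(a, b) \<in> \<Phi> ` cocycles y 2" for a b
      \<comment> \<open>The cocycle with free coordinates a and b; the default a serves both
        \<open>[E1,E1]\<close> and \<open>[E2,E2]\<close>.\<close>
      by (rule image_eqI[of _ _ "\<lambda>w. if w = [E1,E2] then (1 + y^2) * a - y^2 * b
          else if w = [E2,E1] then b else a"])
        (simp_all add: \<Phi>_def cocycles_2[OF y])
    then show "\<Phi> ` cocycles y 2 = carrier (direct_sum (regular_module base_ring) (regular_module base_ring))"
      by (auto simp: direct_sum_simps)
    fix g assume "g \<in> cocycles y 2"
    then show "\<Phi> g = \<Phi> (\<lambda>w. 0) \<longleftrightarrow> (\<exists>h. \<forall>w. length w = 2 \<longrightarrow> g w = coface y 2 h w)"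
      by (auto simp: \<Phi>_def cocycles_2[OF y] coface_2 all_words cong: imp_cong)
  qed (simp_all add: \<Phi>_def direct_sum_simps cocycles_2[OF y] coface_2)
  then show ?thesis by (simp only: Suc_1)
qed

theorem YB_cohomology_3:
  fixes y :: "'k::idom"
  assumes y: "y ^ 4 \<noteq> 1"
  defines "C \<equiv> \<lambda>a :: 'k. quotient_module (regular_module base_ring) (PIdl\<^bsub>base_ring\<^esub> a)"
  shows "module_isomorphic base_ring (YB_cohomology y 3)
    (direct_sum (direct_sum (regular_module base_ring) (regular_module base_ring))
      (direct_sum (C (1 - y^2)) (C (1 - y^4))))" (is "module_isomorphic base_ring _ ?T")
proof -
  define coset where "coset a x = PIdl\<^bsub>base_ring\<^esub> a +>\<^bsub>regular_module base_ring\<^esub> x" for a x :: 'k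
  note mods = regular_module_is_module[OF cring_from_type_algebra]
    cgenideal_submodule[OF cring_from_type_algebra]
  have coset: "carrier (C a) = range (coset a)"
    "coset a x \<oplus>\<^bsub>C a\<^esub> coset a x' = coset a (x + x')"
    "c \<odot>\<^bsub>C a\<^esub> coset a x = coset a (c * x)"
    "coset a x = coset a x' \<longleftrightarrow> a dvd x - x'" for a x x' c
    using module_quotient_add[OF mods, of a x x'] module_quotient_smult[OF mods, of a c x]
    by (simp_all add: C_def coset_def[abs_def] quotient_carrier principal_coset_eq_iff)
  \<comment> \<open>Passing from \<open>g [E1,E2,E2]\<close> to its sum with
    \<open>g [E1,E1,E2]\<close> is an invertible change of coordinates that makes the coboundary
    conditions two separate divisibilities.\<close>
  define \<Phi> where "\<Phi> g = ((g [E1,E1,E1], g [E2,E1,E1]),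
    (coset (1 - y^2) (g [E1,E1,E2]), coset (1 - y^4) (g [E1,E1,E2] + g [E1,E2,E2])))" for g
  have "module_isomorphic base_ring (YB_cohomology y (Suc 2)) ?T"
  proof (rule YB_cohomology_isomorphic[where \<Phi>=\<Phi>], unfold eval_nat_numeral(3)[symmetric])
    have "((a, b), (coset (1 - y^2) c, coset (1 - y^4) d)) \<in> \<Phi> ` cocycles y 3" for a b c d
      \<comment> \<open>The values not chosen freely are those forced by \<open>cocycles_3\<close>;
        d - c makes the sum equal to d, and the default b serves \<open>[E2,E1,E1]\<close> and
        \<open>[E2,E2,E2]\<close>.\<close>
      by (rule image_eqI[of _ _ "\<lambda>w.
          if w = [E1,E2,E1] then (1 + y^2) * a - y^2 * b
          else if w = [E2,E1,E2] then (1 + y^2) * b - y^2 * a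
          else if w = [E1,E1,E1] \<or> w = [E2,E2,E1] then a
          else if w = [E1,E1,E2] then c
          else if w = [E1,E2,E2] then d - c else b"])
        (simp_all add: \<Phi>_def cocycles_3[OF y])
    then show "\<Phi> ` cocycles y 3 = carrier ?T"
      by (auto simp: direct_sum_simps coset \<Phi>_def)
    show "coface y 3 h \<in> cocycles y 3" for h
      by (simp add: cocycles_3[OF y] coface_3)
    fix g assume g: "g \<in> cocycles y 3"
    show "\<Phi> g = \<Phi> (\<lambda>w. 0) \<longleftrightarrow> (\<exists>h. \<forall>w. length w = 3 \<longrightarrow> g w = coface y 3 h w)"
    proof
      assume "\<Phi> g = \<Phi> (\<lambda>w. 0)"
      then have 0: "g [E1,E1,E1] = 0" "g [E2,E1,E1] = 0" "1 - y^2 dvd g [E1,E1,E2]"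
        "1 - y^4 dvd g [E1,E1,E2] + g [E1,E2,E2]"
        by (simp_all add: \<Phi>_def coset)
      then obtain p q where pq: "g [E1,E1,E2] = (1 - y^2) * p"
        "g [E1,E1,E2] + g [E1,E2,E2] = (1 - y^4) * q" unfolding dvd_def by blast
      have "g [E1,E2,E2] = (1 - y^4) * q - (1 - y^2) * p"
        using pq by (metis add_diff_cancel_left')
      then have pq': "g [E1,E2,E2] = (1 - y^2) * ((1 + y^2) * q - p)"
        unfolding one_minus_power4 by (simp add: algebra_simps)
      \<comment> \<open>With \<open>h\<close> zero at \<open>[E2,E1]\<close> and
        \<open>[E2,E2]\<close>, the two nonzero formulas of \<open>coface_3\<close> are solved by
        these values. The other coordinates of \<open>g\<close> vanish, being combinations of
        \<open>g [E1,E1,E1]\<close> and \<open>g [E2,E1,E1]\<close>.\<close>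
      define h where "h w = (if w = [E1,E1] then q else if w = [E1,E2] then (1 + y^2) * q - p else 0)" for w
      have "\<forall>w. length w = 3 \<longrightarrow> g w = coface y 3 h w"
        using g 0(1,2) pq(1) pq' by (simp add: all_words coface_3 cocycles_3[OF y] h_def)
      then show "\<exists>h. \<forall>w. length w = 3 \<longrightarrow> g w = coface y 3 h w" by blast
    next
      assume "\<exists>h. \<forall>w. length w = 3 \<longrightarrow> g w = coface y 3 h w"
      then obtain h where "\<forall>w. length w = 3 \<longrightarrow> g w = coface y 3 h w" by blast
      then have h: "g [E1,E1,E1] = 0" "g [E2,E1,E1] = 0"
        "g [E1,E1,E2] = (1 - y^2) * ((1 + y^2) * h [E1,E1] - h [E1,E2] - y^2 * h [E2,E1])"
        "g [E1,E2,E2] = (1 - y^2) * (h [E1,E2] + y^2 * h [E2,E1] - (1 + y^2) * h [E2,E2])"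
        by (simp_all add: all_words coface_3)
      \<comment> \<open>In the sum the values of \<open>h\<close> at \<open>[E1,E2]\<close> and
        \<open>[E2,E1]\<close> cancel.\<close>
      have "g [E1,E1,E2] + g [E1,E2,E2] = (1 - y^4) * (h [E1,E1] - h [E2,E2])"
        unfolding h one_minus_power4 by (simp add: algebra_simps)
      then have "1 - y^4 dvd g [E1,E1,E2] + g [E1,E2,E2]" by simp
      moreover have "1 - y^2 dvd g [E1,E1,E2]" by (simp add: h)
      ultimately show "\<Phi> g = \<Phi> (\<lambda>w. 0)" by (simp add: \<Phi>_def coset h(1,2))
    qed
  qed (simp_all add: \<Phi>_def direct_sum_simps coset algebra_simps)
  then show ?thesis by simp
qed

text \<open>The fourth power is the monomial of exponent 4, whose coefficient at exponent 0 is 0 and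
  not 1.\<close>

lemma y_var_power_4: "y_var ^ 4 \<noteq> 1"
proof
  assume "y_var ^ 4 = 1"
  then have "Poly_Mapping.single (4::int) (1::rat) = Poly_Mapping.single 0 1"
    by (simp add: y_var_def power4_eq_xxxx mult_single)
  then have "Poly_Mapping.lookup (Poly_Mapping.single (4::int) (1::rat)) 0 = 1" by simp
  then show False by (simp add: lookup_single)
qed

theorem proposition6p1:
  shows "module_isomorphic laurent_ring (YB_cohomology y_var 2)
           (direct_sum (regular_module laurent_ring) (regular_module laurent_ring))
       \<and> module_isomorphic laurent_ring (YB_cohomology y_var 3)
           (direct_sum
             (direct_sum (regular_module laurent_ring) (regular_module laurent_ring))
             (direct_sum (cyclic_quotient (1 - y_var^2)) (cyclic_quotient (1 - y_var^4))))"
  unfolding cyclic_quotient_def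
  using YB_cohomology_2[OF y_var_power_4] YB_cohomology_3[OF y_var_power_4] ..

end
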